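(* Let $G=(V,E)$ be a finite simple graph, let $\tau$ be a finite set of colors, and let $\phi_1\neq\phi_2$ be two different proper $\tau$-colorings of $G$ with coloring characteristic vectors $X(\phi_1),X(\phi_2)\in\{0,1\}^{V\times\tau}$. Then the vector $s:=X(\phi_2)-X(\phi_1)$ is a circuit of the fractional coloring polytope of $G$ and $\tau$ if and only if the graph with vertex set $$V(s)=\{v\in V : s(v,i)\neq 0\text{ for some } i\in\tau\}$$ and edge set $$E(s)=\{uv\in E : s(u,i)+s(v,i)=0 \text{ and } s(u,i)\neq 0\text{ for some } i\in\tau\}$$ is connected.
   Context: A proper $\tau$-coloring of $G$ is a map $\phi:V\to\tau$ with $\phi(u)\neq\phi(v)$ for every edge $uv\in E$. Its coloring characteristic vector $X(\phi)\in\{0,1\}^{V\times\tau}$ has entry $1$ at $(v,i)$ if $\phi(v)=i$ and $0$ otherwise. The fractional coloring polytope of $G$ and $\tau$ is the set of $x\in\mathbb{R}^{V\times\tau}$ satisfying $$\sum_{i\in\tau}x(v,i)=1\ \ \forall v\in V,\qquad x(v,i)+x(u,i)\le 1\ \ \forall i\in\tau,\ uv\in E,\qquad x(v,i)\ge 0\ \ \forall v\in V, i\in\tau.$$ Let $A$ be its equality constraint matrix and $B$ its inequality constraint matrix (rows for the edge/color constraints and for the nonnegativity constraints). Its circuits are the vectors in $\mathcal{C}(A,B)$: the $g\in\ker(A)\setminus\{0\}$, normalized to coprime integer components, for which the support of $Bg$ is inclusion-minimal among the supports of $\{Bx : x\in\ker(A)\setminus\{0\}\}$. *)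

theory Defs
  imports Complex_Main "HOL-Library.FuncSet" "Graph_Theory.Digraph_Component"
begin

section \<open>Circuits of a pair of matrices\<close>

text \<open>
  For a finite index set \<open>N\<close>, the space \<open>\<real>\<^sup>N\<close> is represented by the functions on the ambient type
  that vanish outside \<open>N\<close>. A matrix with columns indexed by \<open>N\<close> is a function of a row index
  and a column index; its set of row indices is passed separately.
\<close>

definition vecs :: "'n set \<Rightarrow> ('n \<Rightarrow> real) set" where
  "vecs N = {x. \<forall>c. c \<notin> N \<longrightarrow> x c = 0}"

definition mat_vec :: "'n set \<Rightarrow> ('r \<Rightarrow> 'n \<Rightarrow> real) \<Rightarrow> ('n \<Rightarrow> real) \<Rightarrow> 'r \<Rightarrow> real" where
  "mat_vec N M x r = (\<Sum>c\<in>N. M r c * x c)"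

definition mat_ker :: "'n set \<Rightarrow> 'r set \<Rightarrow> ('r \<Rightarrow> 'n \<Rightarrow> real) \<Rightarrow> ('n \<Rightarrow> real) set" where
  "mat_ker N R A = {x \<in> vecs N. \<forall>r\<in>R. mat_vec N A x r = 0}"

definition vec_supp :: "'r set \<Rightarrow> ('r \<Rightarrow> real) \<Rightarrow> 'r set" where
  "vec_supp R y = {r \<in> R. y r \<noteq> 0}"

definition coprime_integral :: "'n set \<Rightarrow> ('n \<Rightarrow> real) \<Rightarrow> bool" where
  "coprime_integral N g \<longleftrightarrow>
     (\<exists>z :: 'n \<Rightarrow> int. (\<forall>c\<in>N. g c = of_int (z c)) \<and> Gcd (z ` N) = 1)"

definition circuits ::
  "'n set \<Rightarrow> 'p set \<Rightarrow> ('p \<Rightarrow> 'n \<Rightarrow> real) \<Rightarrow> 'q set \<Rightarrow> ('q \<Rightarrow> 'n \<Rightarrow> real) \<Rightarrow> ('n \<Rightarrow> real) set"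
  where
  "circuits N R A Q B =
     {g \<in> mat_ker N R A - {\<lambda>_. 0}.
        coprime_integral N g \<and>
        \<not> (\<exists>x \<in> mat_ker N R A - {\<lambda>_. 0}.
             vec_supp Q (mat_vec N B x) \<subset> vec_supp Q (mat_vec N B g))}"


section \<open>Colorings and the fractional coloring polytope\<close>

text \<open>
  A finite simple graph is a \<^locale>\<open>pair_graph\<close>: a finite, loop-free, symmetric digraph without
  parallel arcs. An edge \<open>uv\<close> corresponds to the two arcs \<open>(u, v)\<close> and \<open>(v, u)\<close>.
\<close>

definition edges :: "'v pair_pre_digraph \<Rightarrow> 'v set set" where
  "edges G = {{u, v} | u v. (u, v) \<in> parcs G}"

text \<open>
  Colorings are extensional functions, so that two colorings are equal
  iff they agree on the vertices of \<open>G\<close>.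
\<close>

definition proper_coloring :: "'v pair_pre_digraph \<Rightarrow> 'c set \<Rightarrow> ('v \<Rightarrow> 'c) \<Rightarrow> bool" where
  "proper_coloring G \<tau> \<phi> \<longleftrightarrow>
     \<phi> \<in> pverts G \<rightarrow>\<^sub>E \<tau> \<and> (\<forall>u v. (u, v) \<in> parcs G \<longrightarrow> \<phi> u \<noteq> \<phi> v)"

definition coloring_vec ::
  "'v pair_pre_digraph \<Rightarrow> 'c set \<Rightarrow> ('v \<Rightarrow> 'c) \<Rightarrow> 'v \<times> 'c \<Rightarrow> real" where
  "coloring_vec G \<tau> \<phi> = (\<lambda>(v, i). if v \<in> pverts G \<and> i \<in> \<tau> \<and> \<phi> v = i then 1 else 0)"

definition fc_polytope :: "'v pair_pre_digraph \<Rightarrow> 'c set \<Rightarrow> ('v \<times> 'c \<Rightarrow> real) set" where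
  "fc_polytope G \<tau> =
     {x \<in> vecs (pverts G \<times> \<tau>).
        (\<forall>v\<in>pverts G. (\<Sum>i\<in>\<tau>. x (v, i)) = 1) \<and>
        (\<forall>i\<in>\<tau>. \<forall>u v. (u, v) \<in> parcs G \<longrightarrow> x (v, i) + x (u, i) \<le> 1) \<and>
        (\<forall>v\<in>pverts G. \<forall>i\<in>\<tau>. x (v, i) \<ge> 0)}"

definition fc_eq_matrix :: "'v \<Rightarrow> 'v \<times> 'c \<Rightarrow> real" where
  "fc_eq_matrix w = (\<lambda>(v, i). if v = w then 1 else 0)"

datatype ('v, 'c) ineq_row = Edge_Color "'v set" 'c | Nonneg 'v 'c

definition fc_ineq_rows :: "'v pair_pre_digraph \<Rightarrow> 'c set \<Rightarrow> ('v, 'c) ineq_row set" where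
  "fc_ineq_rows G \<tau> =
     {Edge_Color e i | e i. e \<in> edges G \<and> i \<in> \<tau>} \<union> {Nonneg v i | v i. v \<in> pverts G \<and> i \<in> \<tau>}"

text \<open>
  The inequality system is written as \<open>B x \<le> d\<close>, so nonnegativity reads \<open>- x (v, i) \<le> 0\<close>.
\<close>

fun fc_ineq_matrix :: "('v, 'c) ineq_row \<Rightarrow> 'v \<times> 'c \<Rightarrow> real" where
  "fc_ineq_matrix (Edge_Color e i) (v, j) = (if v \<in> e \<and> j = i then 1 else 0)"
| "fc_ineq_matrix (Nonneg w i) (v, j) = (if v = w \<and> j = i then - 1 else 0)"

fun fc_ineq_rhs :: "('v, 'c) ineq_row \<Rightarrow> real" where
  "fc_ineq_rhs (Edge_Color e i) = 1"
| "fc_ineq_rhs (Nonneg w i) = 0"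

definition fc_circuits :: "'v pair_pre_digraph \<Rightarrow> 'c set \<Rightarrow> ('v \<times> 'c \<Rightarrow> real) set" where
  "fc_circuits G \<tau> =
     circuits (pverts G \<times> \<tau>) (pverts G) fc_eq_matrix (fc_ineq_rows G \<tau>) fc_ineq_matrix"

lemma mat_vec_fc_eq_matrix:
  assumes "finite V" "finite \<tau>" "w \<in> V"
  shows "mat_vec (V \<times> \<tau>) fc_eq_matrix x w = (\<Sum>i\<in>\<tau>. x (w, i))"
proof -
  have "mat_vec (V \<times> \<tau>) fc_eq_matrix x w =
      (\<Sum>v\<in>V. \<Sum>i\<in>\<tau>. (if v = w then 1 else 0) * x (v, i))"
    by (simp add: mat_vec_def fc_eq_matrix_def sum.cartesian_product case_prod_beta)
  also have "\<dots> = (\<Sum>v\<in>V. if v = w then \<Sum>i\<in>\<tau>. x (v, i) else 0)"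
    by (rule sum.cong) auto
  finally show ?thesis using assms by simp
qed

lemma mat_vec_Edge_Color:
  assumes "finite V" "finite \<tau>" "u \<in> V" "v \<in> V" "u \<noteq> v" "i \<in> \<tau>"
  shows "mat_vec (V \<times> \<tau>) fc_ineq_matrix x (Edge_Color {u, v} i) = x (v, i) + x (u, i)"
proof -
  have "mat_vec (V \<times> \<tau>) fc_ineq_matrix x (Edge_Color {u, v} i) =
      (\<Sum>c\<in>{(u, i), (v, i)}. fc_ineq_matrix (Edge_Color {u, v} i) c * x c)"
    unfolding mat_vec_def by (rule sum.mono_neutral_right) (use assms in \<open>auto split: if_splits\<close>)
  then show ?thesis using assms by simp
qed

lemma mat_vec_Nonneg:
  assumes "finite V" "finite \<tau>" "v \<in> V" "i \<in> \<tau>"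
  shows "mat_vec (V \<times> \<tau>) fc_ineq_matrix x (Nonneg v i) = - x (v, i)"
proof -
  have "mat_vec (V \<times> \<tau>) fc_ineq_matrix x (Nonneg v i) =
      (\<Sum>c\<in>{(v, i)}. fc_ineq_matrix (Nonneg v i) c * x c)"
    unfolding mat_vec_def by (rule sum.mono_neutral_right) (use assms in \<open>auto split: if_splits\<close>)
  then show ?thesis by simp
qed

lemma fc_polytope_eq:
  assumes "pair_graph G" "finite \<tau>"
  shows "fc_polytope G \<tau> =
    {x \<in> vecs (pverts G \<times> \<tau>).
       (\<forall>w\<in>pverts G. mat_vec (pverts G \<times> \<tau>) fc_eq_matrix x w = 1) \<and>
       (\<forall>r\<in>fc_ineq_rows G \<tau>. mat_vec (pverts G \<times> \<tau>) fc_ineq_matrix x r \<le> fc_ineq_rhs r)}"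
proof -
  interpret pair_graph G by fact
  let ?N = "pverts G \<times> \<tau>"
  have fin: "finite (pverts G)" by (rule pair_finite_verts)
  have E: "mat_vec ?N fc_ineq_matrix x (Edge_Color {u, v} i) = x (v, i) + x (u, i)"
    if "(u, v) \<in> parcs G" "i \<in> \<tau>" for x u v i
    using that pair_no_loops[OF that(1)] fin assms(2)
    by (intro mat_vec_Edge_Color) (auto dest: in_arcsD1 in_arcsD2)
  have ineq: "(\<forall>r\<in>fc_ineq_rows G \<tau>. mat_vec ?N fc_ineq_matrix x r \<le> fc_ineq_rhs r) \<longleftrightarrow>
      (\<forall>i\<in>\<tau>. \<forall>u v. (u, v) \<in> parcs G \<longrightarrow> x (v, i) + x (u, i) \<le> 1) \<and>
      (\<forall>v\<in>pverts G. \<forall>i\<in>\<tau>. x (v, i) \<ge> 0)" (is "?L \<longleftrightarrow> ?R") for x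
  proof
    assume L: ?L
    show ?R
    proof (intro conjI ballI allI impI)
      fix i u v assume *: "i \<in> \<tau>" "(u, v) \<in> parcs G"
      then have "Edge_Color {u, v} i \<in> fc_ineq_rows G \<tau>"
        by (auto simp: fc_ineq_rows_def edges_def)
      with L E[OF *(2,1)] show "x (v, i) + x (u, i) \<le> 1" by fastforce
    next
      fix v i assume *: "v \<in> pverts G" "i \<in> \<tau>"
      then have "Nonneg v i \<in> fc_ineq_rows G \<tau>" by (auto simp: fc_ineq_rows_def)
      with L mat_vec_Nonneg[OF fin assms(2) *] show "x (v, i) \<ge> 0" by fastforce
    qed
  next
    assume ?R
    then show ?L
      using mat_vec_Nonneg[OF fin assms(2)] E by (auto simp: fc_ineq_rows_def edges_def)
  qed
  show ?thesis
    unfolding fc_polytope_def ineq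
    using mat_vec_fc_eq_matrix[OF fin assms(2)] by auto
qed

definition supp_graph ::
  "'v pair_pre_digraph \<Rightarrow> 'c set \<Rightarrow> ('v \<times> 'c \<Rightarrow> real) \<Rightarrow> 'v pair_pre_digraph" where
  "supp_graph G \<tau> s =
     \<lparr> pverts = {v \<in> pverts G. \<exists>i\<in>\<tau>. s (v, i) \<noteq> 0},
       parcs = {(u, v) \<in> parcs G. \<exists>i\<in>\<tau>. s (u, i) + s (v, i) = 0 \<and> s (u, i) \<noteq> 0} \<rparr>"

end

theory Submission
  imports Defs
begin

text \<open>
  The support of \<open>B x\<close> is contained in that of \<open>B s\<close> iff \<open>x\<close> vanishes wherever \<open>s\<close> does and
  \<open>x (u, i) + x (v, i)\<close> vanishes whenever \<open>uv\<close> is an edge with \<open>s (u, i) + s (v, i) = 0\<close>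
  (\<open>fc_ineq_supp_subset_iff\<close>). The arcs of \<open>supp_graph G \<tau> s\<close> are precisely those along which the
  second condition is not already implied by the first.

  If the support graph of a kernel vector \<open>g\<close> splits into two parts with no edge between them,
  then zeroing the rows of \<open>g\<close> in one part gives a kernel vector with strictly smaller support, so
  \<open>g\<close> is not a circuit. This half (\<open>fc_circuit_imp_connected\<close>) holds for every \<open>g\<close>, whether or not
  it comes from colorings.

  Conversely, let \<open>s\<close> be the difference of two colorings. In every row in which \<open>s\<close> is nonzero it
  has exactly the two entries \<open>1\<close> and \<open>-1\<close>, so a kernel vector \<open>x\<close> whose support is contained in
  that of \<open>s\<close> is, in row \<open>v\<close>, a multiple \<open>a v\<close> of \<open>s\<close>. An arc \<open>uv\<close> of the support graph forces
  \<open>a u = a v\<close>. If the support graph is connected, then \<open>x\<close> is therefore a multiple of \<open>s\<close>, and a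
  nonzero multiple does not have smaller support.
\<close>

section \<open>Connectedness and cuts\<close>

text \<open>
  Both directions of the theorem meet connectedness through a vertex set \<open>C\<close> that no arc leaves or
  enters: a vector can be restricted to \<open>C\<close>, and the level sets of a function that is constant
  along arcs have this form.
\<close>

lemma connected_iff_no_cut:
  assumes "pair_wf_digraph H"
  shows "Digraph_Component.connected (with_proj H) \<longleftrightarrow> pverts H \<noteq> {} \<and>
    (\<forall>C \<subseteq> pverts H. C \<noteq> {} \<longrightarrow> (\<forall>(u, v) \<in> parcs H. u \<in> C \<longleftrightarrow> v \<in> C) \<longrightarrow> C = pverts H)"
    (is "?conn \<longleftrightarrow> ?ne \<and> ?nocut")
proof -
  interpret H: pair_wf_digraph H by fact
  let ?S = "mk_symmetric (with_proj H)"
  interpret S: pair_wf_digraph ?S by (rule H.wellformed_mk_symmetric)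
  have arcs: "parcs ?S = parcs H \<union> (parcs H)\<inverse>"
    by (auto simp: parcs_mk_symmetric)
  have conn: "?conn \<longleftrightarrow> ?ne \<and> (\<forall>u\<in>pverts H. \<forall>v\<in>pverts H. u \<rightarrow>\<^sup>*\<^bsub>?S\<^esub> v)"
    by (simp add: connected_def strongly_connected_def)
  show ?thesis
  proof
    assume L: ?conn
    have "C = pverts H"
      if C: "C \<subseteq> pverts H" "C \<noteq> {}" "\<forall>(u, v) \<in> parcs H. u \<in> C \<longleftrightarrow> v \<in> C" for C
    proof -
      obtain u where u: "u \<in> C" using C by blast
      have "v \<in> C" if "v \<in> pverts H" for v
      proof -
        have "u \<rightarrow>\<^sup>*\<^bsub>?S\<^esub> v" using L conn C u that by blast
        then show ?thesis
          by (induction rule: S.reachable_induct) (use u C arcs in auto)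
      qed
      then show ?thesis using C by blast
    qed
    then show "?ne \<and> ?nocut" using L conn by blast
  next
    assume R: "?ne \<and> ?nocut"
    have "u \<rightarrow>\<^sup>*\<^bsub>?S\<^esub> v" if "u \<in> pverts H" "v \<in> pverts H" for u v
    proof -
      let ?C = "{w. u \<rightarrow>\<^sup>*\<^bsub>?S\<^esub> w}"
      have "?C \<subseteq> pverts H" using S.reachable_in_verts by fastforce
      moreover have "u \<in> ?C" using that by simp
      moreover have "a \<in> ?C \<longleftrightarrow> b \<in> ?C" if "(a, b) \<in> parcs H" for a b
        using that arcs S.reachable_adj_trans[of u] by auto
      ultimately have "?C = pverts H" using R by blast
      then show ?thesis using that by blast
    qed
    then show ?conn using R conn by blast
  qed
qed

section \<open>The constraint matrices of the fractional coloring polytope\<close>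

lemma fc_ker_iff:
  assumes "finite (pverts G)" "finite \<tau>"
  shows "x \<in> mat_ker (pverts G \<times> \<tau>) (pverts G) fc_eq_matrix \<longleftrightarrow>
    x \<in> vecs (pverts G \<times> \<tau>) \<and> (\<forall>v\<in>pverts G. (\<Sum>i\<in>\<tau>. x (v, i)) = 0)"
  using mat_vec_fc_eq_matrix[OF assms] by (auto simp: mat_ker_def)

lemma fc_ineq_supp_subset_iff:
  assumes "pair_graph G" "finite \<tau>"
  shows "vec_supp (fc_ineq_rows G \<tau>) (mat_vec (pverts G \<times> \<tau>) fc_ineq_matrix x)
      \<subseteq> vec_supp (fc_ineq_rows G \<tau>) (mat_vec (pverts G \<times> \<tau>) fc_ineq_matrix y) \<longleftrightarrow>
    (\<forall>v\<in>pverts G. \<forall>i\<in>\<tau>. y (v, i) = 0 \<longrightarrow> x (v, i) = 0) \<and>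
    (\<forall>(u, v)\<in>parcs G. \<forall>i\<in>\<tau>. y (u, i) + y (v, i) = 0 \<longrightarrow> x (u, i) + x (v, i) = 0)"
    (is "?supp x \<subseteq> ?supp y \<longleftrightarrow> ?R")
proof -
  interpret pair_graph G by fact
  have nonneg: "Nonneg v i \<in> ?supp z \<longleftrightarrow> v \<in> pverts G \<and> i \<in> \<tau> \<and> z (v, i) \<noteq> 0" for z v i
    using mat_vec_Nonneg[OF pair_finite_verts assms(2), of v i z]
    by (auto simp: vec_supp_def fc_ineq_rows_def)
  have edge: "Edge_Color {u, v} i \<in> ?supp z \<longleftrightarrow> z (u, i) + z (v, i) \<noteq> 0"
    if "(u, v) \<in> parcs G" "i \<in> \<tau>" for z u v i
  proof -
    have "u \<in> pverts G" "v \<in> pverts G" "u \<noteq> v"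
      using that(1) pair_no_loops[OF that(1)] by (auto dest: in_arcsD1 in_arcsD2)
    then have "mat_vec (pverts G \<times> \<tau>) fc_ineq_matrix z (Edge_Color {u, v} i) = z (v, i) + z (u, i)"
      using that pair_finite_verts assms(2) by (intro mat_vec_Edge_Color)
    moreover have "Edge_Color {u, v} i \<in> fc_ineq_rows G \<tau>"
      using that by (auto simp: fc_ineq_rows_def edges_def)
    ultimately show ?thesis by (simp add: vec_supp_def add.commute)
  qed
  show ?thesis
  proof
    assume "?supp x \<subseteq> ?supp y"
    then show ?R using nonneg edge by blast
  next
    assume R: ?R
    show "?supp x \<subseteq> ?supp y"
    proof
      fix r assume r: "r \<in> ?supp x"
      then have "r \<in> fc_ineq_rows G \<tau>" by (simp add: vec_supp_def)
      then consider v i where "r = Nonneg v i"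
        | u v i where "r = Edge_Color {u, v} i" "(u, v) \<in> parcs G" "i \<in> \<tau>"
        by (auto simp: fc_ineq_rows_def edges_def)
      then show "r \<in> ?supp y"
        by cases (use r R nonneg edge in auto)
    qed
  qed
qed

lemma fc_ker_support_vertex:
  assumes "x \<in> mat_ker (pverts G \<times> \<tau>) (pverts G) fc_eq_matrix - {\<lambda>_. 0}"
  obtains v i where "v \<in> pverts G" "i \<in> \<tau>" "x (v, i) \<noteq> 0"
  using assms by (fastforce simp: mat_ker_def vecs_def fun_eq_iff)

lemma pair_wf_digraph_supp_graph:
  assumes "pair_graph G"
  shows "pair_wf_digraph (supp_graph G \<tau> s)"
proof -
  interpret pair_graph G by fact
  have "s (v, i) \<noteq> 0" if "s (u, i) + s (v, i) = 0" "s (u, i) \<noteq> 0" for u v i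
    using that by auto
  then show ?thesis
    by unfold_locales (fastforce simp: supp_graph_def dest: in_arcsD1 in_arcsD2)+
qed

section \<open>Circuits have connected support graphs\<close>

text \<open>
  Restricting \<open>g\<close> to the rows in a union \<open>C\<close> of components keeps all the row sums zero, and it
  creates no new nonzero entry of \<open>B g\<close>: an edge-color sum that cancels in \<open>g\<close> with nonzero
  summands has both endpoints in \<open>C\<close> or both outside. Rows lost outside \<open>C\<close> make the support
  strictly smaller.
\<close>

lemma fc_circuit_imp_connected:
  assumes G: "pair_graph G" and fin: "finite \<tau>" and g: "g \<in> fc_circuits G \<tau>"
  shows "Digraph_Component.connected (with_proj (supp_graph G \<tau> g))"
proof -
  interpret pair_graph G by fact
  let ?H = "supp_graph G \<tau> g"
  let ?K = "mat_ker (pverts G \<times> \<tau>) (pverts G) fc_eq_matrix"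
  let ?supp = "\<lambda>x. vec_supp (fc_ineq_rows G \<tau>) (mat_vec (pverts G \<times> \<tau>) fc_ineq_matrix x)"
  note ker_iff = fc_ker_iff[OF pair_finite_verts fin]
  have gK: "g \<in> ?K - {\<lambda>_. 0}"
    and min: "\<And>x. x \<in> ?K - {\<lambda>_. 0} \<Longrightarrow> \<not> ?supp x \<subset> ?supp g"
    using g by (auto simp: fc_circuits_def circuits_def)
  have "pverts ?H \<noteq> {}"
    using gK by (rule fc_ker_support_vertex) (auto simp: supp_graph_def)
  moreover have "C = pverts ?H"
    if C: "C \<subseteq> pverts ?H" "C \<noteq> {}" "\<forall>(u, v) \<in> parcs ?H. u \<in> C \<longleftrightarrow> v \<in> C" for C
  proof -
    define x where "x = (\<lambda>(v, i). if v \<in> C then g (v, i) else 0)"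
    obtain w j where w: "w \<in> C" "w \<in> pverts G" "j \<in> \<tau>" "g (w, j) \<noteq> 0"
      using C(1,2) unfolding supp_graph_def by fastforce
    then have "x (w, j) \<noteq> 0" by (simp add: x_def)
    then have "x \<noteq> (\<lambda>_. 0)" by force
    moreover have "(\<Sum>i\<in>\<tau>. x (v, i)) = (if v \<in> C then \<Sum>i\<in>\<tau>. g (v, i) else 0)" for v
      by (simp add: x_def)
    then have "x \<in> ?K"
      using gK unfolding Diff_iff ker_iff by (auto simp: x_def vecs_def)
    moreover have "?supp x \<subseteq> ?supp g"
      unfolding fc_ineq_supp_subset_iff[OF G fin]
    proof (intro conjI ballI impI, safe)
      fix u v i assume uv: "(u, v) \<in> parcs G" "i \<in> \<tau>" "g (u, i) + g (v, i) = 0"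
      show "x (u, i) + x (v, i) = 0"
      proof (cases "g (u, i) = 0")
        case False
        then have "(u, v) \<in> parcs ?H" using uv by (auto simp: supp_graph_def)
        then have "u \<in> C \<longleftrightarrow> v \<in> C" using C by blast
        then show ?thesis using uv by (simp add: x_def)
      qed (use uv in \<open>simp add: x_def\<close>)
    qed (simp add: x_def)
    ultimately have "?supp g \<subseteq> ?supp x"
      using min by blast
    then have zero: "g (v, i) = 0" if "v \<in> pverts G" "i \<in> \<tau>" "x (v, i) = 0" for v i
      using that unfolding fc_ineq_supp_subset_iff[OF G fin] by blast
    have "v \<in> C" if "v \<in> pverts ?H" for v
    proof (rule ccontr)
      assume "v \<notin> C"
      then have "x (v, i) = 0" for i by (simp add: x_def)
      then show False using that zero unfolding supp_graph_def by auto
    qed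
    then show ?thesis using C by blast
  qed
  ultimately show ?thesis
    unfolding connected_iff_no_cut[OF pair_wf_digraph_supp_graph[OF G]] by blast
qed

section \<open>Connected support graphs force minimality\<close>

text \<open>
  Along an arc \<open>uv\<close> of the support graph there is a color with \<open>s (v, i) = - s (u, i) \<noteq> 0\<close>, and
  cancellation in \<open>x\<close> then forces the factors at \<open>u\<close> and \<open>v\<close> to agree. So the factor is constant
  on a connected support graph.
\<close>

lemma global_multiple_if_rowwise_multiple:
  fixes x s :: "'v \<times> 'c \<Rightarrow> real" and a :: "'v \<Rightarrow> real"
  assumes G: "pair_graph G"
    and conn: "Digraph_Component.connected (with_proj (supp_graph G \<tau> s))"
    and row: "\<And>v i. v \<in> pverts G \<Longrightarrow> i \<in> \<tau> \<Longrightarrow> x (v, i) = a v * s (v, i)"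
    and cancel: "\<And>u v i. (u, v) \<in> parcs G \<Longrightarrow> i \<in> \<tau> \<Longrightarrow> s (u, i) + s (v, i) = 0 \<Longrightarrow>
      x (u, i) + x (v, i) = 0"
  obtains b where "\<And>v i. v \<in> pverts G \<Longrightarrow> i \<in> \<tau> \<Longrightarrow> x (v, i) = b * s (v, i)"
proof -
  interpret pair_graph G by fact
  let ?H = "supp_graph G \<tau> s"
  note no_cut = conn[unfolded connected_iff_no_cut[OF pair_wf_digraph_supp_graph[OF G]]]
  obtain w where w: "w \<in> pverts ?H" using no_cut by blast
  let ?C = "{v \<in> pverts ?H. a v = a w}"
  have "a u = a v \<and> u \<in> pverts ?H \<and> v \<in> pverts ?H" if uv: "(u, v) \<in> parcs ?H" for u v
  proof -
    obtain i where i: "(u, v) \<in> parcs G" "i \<in> \<tau>" "s (u, i) + s (v, i) = 0" "s (u, i) \<noteq> 0"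
      using uv by (auto simp: supp_graph_def)
    have verts: "u \<in> pverts G" "v \<in> pverts G" using i(1) by (auto dest: in_arcsD1 in_arcsD2)
    have neg: "s (v, i) = - s (u, i)" using i(3) by simp
    have "a u * s (u, i) + a v * s (v, i) = 0"
      using cancel[OF i(1-3)] row[OF verts(1) i(2)] row[OF verts(2) i(2)] by simp
    then have "a u = a v" using i(4) by (simp add: neg)
    moreover have "s (v, i) \<noteq> 0" using i(4) neg by simp
    then have "u \<in> pverts ?H" "v \<in> pverts ?H"
      using verts i(2,4) unfolding supp_graph_def by auto
    ultimately show ?thesis by simp
  qed
  then have "\<forall>(u, v) \<in> parcs ?H. u \<in> ?C \<longleftrightarrow> v \<in> ?C" by auto
  moreover have "?C \<noteq> {}" "?C \<subseteq> pverts ?H" using w by auto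
  ultimately have "?C = pverts ?H" using no_cut by blast
  then have "x (v, i) = a w * s (v, i)" if "v \<in> pverts G" "i \<in> \<tau>" for v i
    using row[OF that] that by (cases "s (v, i) = 0") (auto simp: supp_graph_def)
  then show ?thesis by (rule that)
qed

section \<open>Differences of colorings\<close>

lemma coloring_vec_row_sum:
  assumes "proper_coloring G \<tau> \<phi>" "finite \<tau>" "v \<in> pverts G"
  shows "(\<Sum>i\<in>\<tau>. coloring_vec G \<tau> \<phi> (v, i)) = 1"
proof -
  have "\<phi> v \<in> \<tau>" using assms by (auto simp: proper_coloring_def)
  moreover have "(\<Sum>i\<in>\<tau>. coloring_vec G \<tau> \<phi> (v, i)) = (\<Sum>i\<in>\<tau>. if \<phi> v = i then 1 else 0)"
    using assms by (intro sum.cong) (auto simp: coloring_vec_def)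
  ultimately show ?thesis using assms by simp
qed

text \<open>
  At a recolored vertex the difference has only the entries \<open>1\<close> and \<open>-1\<close>, so zero row sum leaves
  \<open>x\<close> one degree of freedom: its value at the new color. At any other vertex the row is zero and
  every factor works.
\<close>

lemma row_multiple_of_coloring_difference:
  assumes \<phi>1: "proper_coloring G \<tau> \<phi>\<^sub>1" and \<phi>2: "proper_coloring G \<tau> \<phi>\<^sub>2" and fin: "finite \<tau>"
    and s: "s = (\<lambda>c. coloring_vec G \<tau> \<phi>\<^sub>2 c - coloring_vec G \<tau> \<phi>\<^sub>1 c)"
    and v: "v \<in> pverts G" and i: "i \<in> \<tau>"
    and sum: "(\<Sum>i\<in>\<tau>. x (v, i)) = (0::real)"
    and supp: "\<And>i. i \<in> \<tau> \<Longrightarrow> s (v, i) = 0 \<Longrightarrow> x (v, i) = 0"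
  shows "x (v, i) = x (v, \<phi>\<^sub>2 v) * s (v, i)"
proof -
  have col: "\<phi>\<^sub>1 v \<in> \<tau>" "\<phi>\<^sub>2 v \<in> \<tau>" using \<phi>1 \<phi>2 v by (auto simp: proper_coloring_def)
  have entry: "s (v, j) = (if \<phi>\<^sub>2 v = j then 1 else 0) - (if \<phi>\<^sub>1 v = j then 1 else 0)"
    if "j \<in> \<tau>" for j
    using v that by (simp add: s coloring_vec_def)
  show ?thesis
  proof (cases "\<phi>\<^sub>1 v = \<phi>\<^sub>2 v")
    case True
    then show ?thesis using entry[OF i] supp[OF i] by simp
  next
    case False
    have "x (v, j) = 0" if "j \<in> \<tau> - {\<phi>\<^sub>1 v, \<phi>\<^sub>2 v}" for j
      using that supp[of j] entry[of j] by auto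
    then have "(\<Sum>i\<in>\<tau>. x (v, i)) = (\<Sum>i\<in>{\<phi>\<^sub>1 v, \<phi>\<^sub>2 v}. x (v, i))"
      using fin col by (intro sum.mono_neutral_right) auto
    then have "x (v, \<phi>\<^sub>1 v) = - x (v, \<phi>\<^sub>2 v)" using sum False by simp
    then show ?thesis using entry[OF i] supp[OF i] False by auto
  qed
qed

theorem theorem3p2:
  fixes G :: "'v pair_pre_digraph" and \<tau> :: "'c set" and \<phi>\<^sub>1 \<phi>\<^sub>2 :: "'v \<Rightarrow> 'c"
    and s :: "'v \<times> 'c \<Rightarrow> real"
  assumes "pair_graph G"
    and "finite \<tau>"
    and "proper_coloring G \<tau> \<phi>\<^sub>1" and "proper_coloring G \<tau> \<phi>\<^sub>2"
    and "\<phi>\<^sub>1 \<noteq> \<phi>\<^sub>2"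
    and "s = (\<lambda>c. coloring_vec G \<tau> \<phi>\<^sub>2 c - coloring_vec G \<tau> \<phi>\<^sub>1 c)"
  shows "s \<in> fc_circuits G \<tau> \<longleftrightarrow>
    Digraph_Component.connected (with_proj (supp_graph G \<tau> s))"
proof
  assume "s \<in> fc_circuits G \<tau>"
  then show "Digraph_Component.connected (with_proj (supp_graph G \<tau> s))"
    using assms(1,2) by (rule fc_circuit_imp_connected[rotated 2])
next
  assume conn: "Digraph_Component.connected (with_proj (supp_graph G \<tau> s))"
  interpret pair_graph G by fact
  let ?N = "pverts G \<times> \<tau>"
  let ?K = "mat_ker ?N (pverts G) fc_eq_matrix"
  let ?supp = "\<lambda>x. vec_supp (fc_ineq_rows G \<tau>) (mat_vec ?N fc_ineq_matrix x)"
  note ker_iff = fc_ker_iff[OF pair_finite_verts assms(2)]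
  note supp_iff = fc_ineq_supp_subset_iff[OF assms(1,2)]
  obtain w where w: "w \<in> pverts G" "\<phi>\<^sub>1 w \<noteq> \<phi>\<^sub>2 w"
    using assms(3-5) unfolding proper_coloring_def by (meson PiE_ext)
  have wc: "(w, \<phi>\<^sub>2 w) \<in> ?N" using w assms(4) by (auto simp: proper_coloring_def)
  have sw: "s (w, \<phi>\<^sub>2 w) = 1"
    using w wc by (simp add: assms(6) coloring_vec_def)
  have "s \<in> ?K"
    unfolding ker_iff
    by (auto simp: vecs_def assms(6) sum_subtractf coloring_vec_row_sum[OF assms(3,2)]
        coloring_vec_row_sum[OF assms(4,2)])
      (auto simp: coloring_vec_def)
  moreover have "s \<noteq> (\<lambda>_. 0)" using sw by force
  moreover have "coprime_integral ?N s"
  proof -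
    define z :: "'v \<times> 'c \<Rightarrow> int" where "z c = \<lfloor>s c\<rfloor>" for c
    have "s c = of_int (z c)" for c
      by (cases c) (simp add: z_def assms(6) coloring_vec_def)
    moreover have "1 \<in> z ` ?N" using wc sw by (force simp: z_def)
    then have "Gcd (z ` ?N) = 1" by (metis Gcd_1)
    ultimately show ?thesis unfolding coprime_integral_def by blast
  qed
  moreover have "\<not> ?supp x \<subset> ?supp s" if x: "x \<in> ?K - {\<lambda>_. 0}" for x
  proof
    assume sub: "?supp x \<subset> ?supp s"
    then have "?supp x \<subseteq> ?supp s" by blast
    then have vanish: "\<And>v i. v \<in> pverts G \<Longrightarrow> i \<in> \<tau> \<Longrightarrow> s (v, i) = 0 \<Longrightarrow> x (v, i) = 0"
      and cancel: "\<And>u v i. (u, v) \<in> parcs G \<Longrightarrow> i \<in> \<tau> \<Longrightarrow> s (u, i) + s (v, i) = 0 \<Longrightarrow>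
        x (u, i) + x (v, i) = 0"
      unfolding supp_iff by blast+
    have row: "x (v, i) = x (v, \<phi>\<^sub>2 v) * s (v, i)" if "v \<in> pverts G" "i \<in> \<tau>" for v i
      using x that vanish unfolding Diff_iff ker_iff
      by (intro row_multiple_of_coloring_difference[OF assms(3,4,2,6)]) auto
    obtain b where b: "\<And>v i. v \<in> pverts G \<Longrightarrow> i \<in> \<tau> \<Longrightarrow> x (v, i) = b * s (v, i)"
      using global_multiple_if_rowwise_multiple[OF assms(1) conn row cancel] by blast
    obtain v i where "v \<in> pverts G" "i \<in> \<tau>" "x (v, i) \<noteq> 0"
      using x by (rule fc_ker_support_vertex)
    then have "b \<noteq> 0" using b by fastforce
    have "?supp s \<subseteq> ?supp x"
      unfolding supp_iff
    proof (intro conjI ballI impI, safe)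
      fix u v i assume uv: "(u, v) \<in> parcs G" "i \<in> \<tau>" "x (u, i) + x (v, i) = 0"
      then have "u \<in> pverts G" "v \<in> pverts G" by (auto dest: in_arcsD1 in_arcsD2)
      then have "b * (s (u, i) + s (v, i)) = 0" using uv b by (simp add: distrib_left)
      then show "s (u, i) + s (v, i) = 0" using \<open>b \<noteq> 0\<close> by simp
    qed (use b \<open>b \<noteq> 0\<close> in simp)
    then show False using sub by blast
  qed
  ultimately show "s \<in> fc_circuits G \<tau>"
    unfolding fc_circuits_def circuits_def by blast
qed

end
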